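(* Let $n\ge 1$, let $Q$ be a closed cube in $\mathbb{R}^n$ and let $Q_1$ be a neighbourhood of $Q$. Let $\sigma\colon Q_1\to\mathbb{R}$ be a twice differentiable function whose second partial derivatives are uniformly bounded, and suppose that $|\sigma|<1$ in $Q$. Let $f\colon(0,1]\to\mathbb{R}$ be a strictly decreasing positive smooth function such that $f(\xi)\sqrt{\xi}$ is bounded on $(0,1]$ and $\int_0^1 \frac{f(\xi)}{\sqrt{\xi}}\,d\xi$ converges. For $a>0$ set $$\Gamma_1(a)=\int_Q \Big\|\widetilde{\partial\sigma/\partial x}^{\,a}\Big\|\,d\mu,\qquad \Gamma_2(a)=\int_Q\Big[\big\|\partial\sigma/\partial x\big\|-\Big\|\widetilde{\partial\sigma/\partial x}^{\,a}\Big\|\Big]f(|\sigma|)\,d\mu .$$ Then there exist positive constants $C_1,C_2$, not depending on $a$, such that for all $0<a<1/2$ $$\Gamma_1(a)<C_1\sqrt a,\qquad \Gamma_2(a)<C_2 .$$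
   Context: Coordinates in $\mathbb{R}^n$ are $x=(x_1,\dots,x_n)$, and $d\mu=dx_1\cdots dx_n$ is the volume element. $\partial\sigma/\partial x=(\partial\sigma/\partial x_1,\dots,\partial\sigma/\partial x_n)$ is the gradient of $\sigma$, and $\|\cdot\|$ is the Euclidean norm. For $a>0$ the truncated gradient is defined pointwise by $$\widetilde{\partial\sigma/\partial x}^{\,a}=\begin{cases}\partial\sigma/\partial x, & \text{if } |\sigma|<a,\\ 0, & \text{if } |\sigma|\ge a.\end{cases}$$ Integrals are understood in the sense of Riemann. The integrand of $\Gamma_2(a)$ is defined by continuity at points where $\sigma=0$, where it equals $0$. "Constants not depending on $a$" may depend on $Q,\sigma,f,n$. *)

theory Defs
  imports "HOL-Analysis.Analysis"
begin

text \<open>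
  The library's gauge integral is more general than the Riemann integral, so the latter is
  introduced here: the Riemann sums converge as the mesh (the largest diameter of a cell) tends
  to zero. It is meant for boxes; other sets may have no tagged divisions at all.
\<close>

definition has_riemann_integral ::
    "('a::euclidean_space \<Rightarrow> real) \<Rightarrow> real \<Rightarrow> 'a set \<Rightarrow> bool" where
  "has_riemann_integral g I S \<longleftrightarrow>
     (\<forall>e>0. \<exists>d>0. \<forall>p. p tagged_division_of S \<and> (\<forall>(x, K)\<in>p. diameter K < d) \<longrightarrow>
        \<bar>(\<Sum>(x, K)\<in>p. measure lborel K * g x) - I\<bar> < e)"

definition riemann_integrable_on ::
    "('a::euclidean_space \<Rightarrow> real) \<Rightarrow> 'a set \<Rightarrow> bool" (infixr "riemann'_integrable'_on" 46) where
  "g riemann_integrable_on S \<longleftrightarrow> (\<exists>I. has_riemann_integral g I S)"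

definition riemann_integral :: "'a::euclidean_space set \<Rightarrow> ('a \<Rightarrow> real) \<Rightarrow> real" where
  "riemann_integral S g = (THE I. has_riemann_integral g I S)"

lemma has_riemann_integral_imp_has_integral:
  fixes a b :: "'a::euclidean_space"
  assumes "has_riemann_integral g I (cbox a b)"
  shows "(g has_integral I) (cbox a b)"
  unfolding has_integral
proof (intro allI impI)
  fix e :: real
  assume "e > 0"
  then obtain d where "d > 0" and
    d: "\<And>p. p tagged_division_of cbox a b \<Longrightarrow> (\<forall>(x, K)\<in>p. diameter K < d) \<Longrightarrow>
          \<bar>(\<Sum>(x, K)\<in>p. measure lborel K * g x) - I\<bar> < e"
    using assms unfolding has_riemann_integral_def by meson
  show "\<exists>\<gamma>. gauge \<gamma> \<and> (\<forall>p. p tagged_division_of cbox a b \<and> \<gamma> fine p \<longrightarrow>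
          norm ((\<Sum>(x, K)\<in>p. measure lborel K *\<^sub>R g x) - I) < e)"
  proof (intro exI conjI allI impI; (elim conjE)?)
    show "gauge (\<lambda>x. ball x (d / 3))"
      using \<open>d > 0\<close> by (simp add: gauge_ball)
    fix p
    assume p: "p tagged_division_of cbox a b" "(\<lambda>x. ball x (d / 3)) fine p"
    have "diameter K < d" if "(x, K) \<in> p" for x K
    proof -
      have "K \<subseteq> ball x (d / 3)"
        using p(2) that by (auto simp: fine_def)
      then have "diameter K \<le> diameter (ball x (d / 3))"
        by (intro diameter_subset) auto
      with \<open>d > 0\<close> show ?thesis by simp
    qed
    then show "norm ((\<Sum>(x, K)\<in>p. measure lborel K *\<^sub>R g x) - I) < e"
      using d[OF p(1)] by auto
  qed
qed

lemma riemann_integral_unique: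
  fixes a b :: "'a::euclidean_space"
  assumes "has_riemann_integral g I (cbox a b)"
  shows "riemann_integral (cbox a b) g = I"
  unfolding riemann_integral_def
  using assms has_riemann_integral_imp_has_integral has_integral_unique by blast

text \<open>Convergence at 0 of the improper Riemann integral from 0 to 1.\<close>

definition improper_integral_converges :: "(real \<Rightarrow> real) \<Rightarrow> bool" where
  "improper_integral_converges g \<longleftrightarrow>
     (\<forall>\<epsilon>\<in>{0<..1}. g riemann_integrable_on {\<epsilon>..1}) \<and>
     (\<exists>L. ((\<lambda>\<epsilon>. riemann_integral {\<epsilon>..1} g) \<longlongrightarrow> L) (at_right 0))"

text \<open>Derivatives are taken relative to \<open>S\<close>, hence one-sided at an end point of an interval.\<close>

definition smooth_real_on :: "real set \<Rightarrow> (real \<Rightarrow> real) \<Rightarrow> bool" where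
  "smooth_real_on S f \<longleftrightarrow>
     (\<exists>F :: nat \<Rightarrow> real \<Rightarrow> real. F 0 = f \<and>
        (\<forall>k. \<forall>x\<in>S. (F k has_real_derivative F (Suc k) x) (at x within S)))"

definition closed_cube :: "(real ^ 'n) set \<Rightarrow> bool" where
  "closed_cube Q \<longleftrightarrow> (\<exists>c l. 0 < l \<and> Q = cbox c (\<chi> i. c $ i + l))"

definition partial_deriv :: "'n \<Rightarrow> (real ^ 'n \<Rightarrow> real) \<Rightarrow> real ^ 'n \<Rightarrow> real" where
  "partial_deriv i g x = deriv (\<lambda>t. g (x + t *\<^sub>R axis i 1)) 0"

definition grad :: "(real ^ 'n \<Rightarrow> real) \<Rightarrow> real ^ 'n \<Rightarrow> real ^ 'n" where
  "grad g x = (\<chi> i. partial_deriv i g x)"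

definition twice_differentiable_on :: "(real ^ 'n \<Rightarrow> real) \<Rightarrow> (real ^ 'n) set \<Rightarrow> bool"
    (infixr "twice'_differentiable'_on" 46) where
  "g twice_differentiable_on S \<longleftrightarrow>
     (\<forall>x\<in>S. g differentiable (at x)) \<and> (\<forall>x\<in>S. grad g differentiable (at x))"

definition truncated_grad ::
    "real \<Rightarrow> (real ^ 'n \<Rightarrow> real) \<Rightarrow> real ^ 'n \<Rightarrow> real ^ 'n" where
  "truncated_grad a \<sigma> x = (if \<bar>\<sigma> x\<bar> < a then grad \<sigma> x else 0)"

definition Gamma1_integrand :: "(real ^ 'n \<Rightarrow> real) \<Rightarrow> real \<Rightarrow> real ^ 'n \<Rightarrow> real" where
  "Gamma1_integrand \<sigma> a x = norm (truncated_grad a \<sigma> x)"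

text \<open>\<open>f\<close> is only given on \<open>(0,1]\<close>; where \<open>\<sigma> = 0\<close> the integrand is extended by continuity.\<close>

definition Gamma2_integrand ::
    "(real ^ 'n \<Rightarrow> real) \<Rightarrow> (real \<Rightarrow> real) \<Rightarrow> real \<Rightarrow> real ^ 'n \<Rightarrow> real" where
  "Gamma2_integrand \<sigma> f a x =
     (if \<sigma> x = 0 then 0
      else (norm (grad \<sigma> x) - norm (truncated_grad a \<sigma> x)) * f \<bar>\<sigma> x\<bar>)"

definition Gamma1 :: "(real ^ 'n) set \<Rightarrow> (real ^ 'n \<Rightarrow> real) \<Rightarrow> real \<Rightarrow> real" where
  "Gamma1 Q \<sigma> a = riemann_integral Q (Gamma1_integrand \<sigma> a)"

definition Gamma2 ::
    "(real ^ 'n) set \<Rightarrow> (real ^ 'n \<Rightarrow> real) \<Rightarrow> (real \<Rightarrow> real) \<Rightarrow> real \<Rightarrow> real" where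
  "Gamma2 Q \<sigma> f a = riemann_integral Q (Gamma2_integrand \<sigma> f a)"

end

theory Submission
  imports Defs
begin

text \<open>
  Everything rests on one estimate, uniform in \<open>c\<close> and \<open>e > 0\<close>: the integral over \<open>Q\<close> of
  \<open>\<parallel>\<partial>\<sigma>/\<partial>x\<parallel> / sqrt (\<bar>\<sigma> - c\<bar> + e)\<close> is at most a constant \<open>C\<close>. Along a line the integrand is the
  derivative of \<open>\<Psi> (\<sigma> - c)\<close> up to sign, where \<open>\<Psi>\<close> is Hoelder continuous of exponent \<open>1/2\<close>; after a
  zero of the directional derivative, \<open>\<sigma>\<close> varies by at most \<open>M d\<^sup>2\<close> over a distance \<open>d\<close>, so \<open>\<Psi>\<close> varies
  by \<open>O(d)\<close>.

  With \<open>c = 0\<close> and \<open>e = a\<close> this gives both bounds, because \<open>1 \<le> sqrt (2 a) / sqrt (\<bar>\<sigma>\<bar> + a)\<close> where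
  \<open>\<bar>\<sigma>\<bar> < a\<close>, and \<open>f \<bar>\<sigma>\<bar> \<le> B / sqrt \<bar>\<sigma>\<bar> \<le> sqrt 2 B / sqrt (\<bar>\<sigma>\<bar> + a)\<close> where \<open>\<bar>\<sigma>\<bar> \<ge> a\<close>. With
  \<open>c = \<plusminus>a\<close> and \<open>e \<rightarrow> 0\<close> it shows that the layers \<open>\<bar>\<bar>\<sigma>\<bar> - a\<bar> \<le> e\<close> contribute \<open>O(sqrt e)\<close>, so the
  truncated integrands lie between continuous functions with arbitrarily close integrals and
  are Riemann integrable.
\<close>

section \<open>Riemann integrability: continuous functions and functions squeezed between
  them\<close>

text \<open>Uniform continuity on the compact box keeps \<open>g\<close> within \<open>e'\<close> of
  its tag value on every cell of small diameter, so each cell contributes an error of at most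
  \<open>e'\<close> times its volume.\<close>

lemma has_riemann_integral_continuous:
  fixes g :: "'a::euclidean_space \<Rightarrow> real"
  assumes cont: "continuous_on (cbox a b) g"
  shows "has_riemann_integral g (integral (cbox a b) g) (cbox a b)"
  unfolding has_riemann_integral_def
proof (intro allI impI)
  fix e :: real
  assume "e > 0"
  \<comment> \<open>The summand 1 keeps the denominator positive for a degenerate box and makes the
    total error strictly less than \<open>e\<close>.\<close>
  define e' where "e' = e / (measure lborel (cbox a b) + 1)"
  have "e' > 0"
    using \<open>e > 0\<close> measure_nonneg[of lborel "cbox a b"] by (simp add: e'_def add_nonneg_pos)
  have e': "e' * measure lborel (cbox a b) < e"
  proof -
    have "e' * measure lborel (cbox a b) < e' * (measure lborel (cbox a b) + 1)"
      using \<open>e' > 0\<close> by simp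
    also have "\<dots> = e"
      using measure_nonneg[of lborel "cbox a b"] unfolding e'_def by (simp add: add_nonneg_eq_0_iff)
    finally show ?thesis .
  qed
  obtain d where "d > 0" and
    d: "\<And>x y. \<lbrakk>x \<in> cbox a b; y \<in> cbox a b; dist y x < d\<rbrakk> \<Longrightarrow> dist (g y) (g x) < e'"
    using compact_uniformly_continuous[OF cont] \<open>e' > 0\<close>
    unfolding uniformly_continuous_on_def by (metis compact_cbox)
  have int: "g integrable_on cbox a b"
    using cont by (rule integrable_continuous)
  have "\<bar>(\<Sum>(x, K)\<in>p. measure lborel K * g x) - integral (cbox a b) g\<bar> < e"
    if p: "p tagged_division_of cbox a b" and mesh: "\<forall>(x, K)\<in>p. diameter K < d" for p
  proof -
    have cell: "\<bar>measure lborel K * g x - integral K g\<bar> \<le> e' * measure lborel K" if xK: "(x, K) \<in> p" for x K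
    proof -
      obtain u v where K: "K = cbox u v"
        using tagged_division_ofD(4)[OF p xK] by blast
      have sub: "x \<in> K" "K \<subseteq> cbox a b"
        using tagged_division_ofD(2,3)[OF p xK] by auto
      have bound: "norm (g x - g y) \<le> e'" if "y \<in> K" for y
      proof -
        have "dist x y \<le> diameter K"
          using diameter_bounded_bound[of K x y] sub that K by simp
        then have "dist x y < d"
          using mesh xK by fastforce
        then have "dist (g x) (g y) < e'"
          using sub that by (intro d) auto
        then show ?thesis
          by (simp add: dist_norm)
      qed
      have "g integrable_on K"
        using integrable_on_subcbox[OF int, of u v] sub(2) K by simp
      then have "((\<lambda>y. g x - g y) has_integral (measure lborel K * g x - integral K g)) K"
        using has_integral_diff[OF has_integral_const[of "g x" u v] integrable_integral, of g] K by simp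
      then show ?thesis
        using has_integral_bound[of e' "\<lambda>y. g x - g y" _ u v] bound K \<open>e' > 0\<close> by simp
    qed
    have "(\<Sum>(x, K)\<in>p. measure lborel K * g x) - integral (cbox a b) g
        = (\<Sum>(x, K)\<in>p. measure lborel K * g x - integral K g)"
      using integral_combine_tagged_division_topdown[OF int p]
      by (simp add: sum_subtractf case_prod_unfold)
    also have "\<bar>\<dots>\<bar> \<le> (\<Sum>(x, K)\<in>p. e' * measure lborel K)"
      using cell by (intro order_trans[OF sum_abs] sum_mono) auto
    also have "\<dots> = e' * measure lborel (cbox a b)"
      using additive_content_tagged_division[OF p] by (simp add: sum_distrib_left[symmetric] case_prod_unfold)
    finally show ?thesis
      using e' by simp
  qed
  then show "\<exists>d>0. \<forall>p. p tagged_division_of cbox a b \<and> (\<forall>(x, K)\<in>p. diameter K < d) \<longrightarrow>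
      \<bar>(\<Sum>(x, K)\<in>p. measure lborel K * g x) - integral (cbox a b) g\<bar> < e"
    using \<open>d > 0\<close> by blast
qed

text \<open>Cell volumes are nonnegative, so over any tagged division the sum of \<open>g\<close>
  lies between those of \<open>l\<close> and \<open>u\<close>. For fine meshes these are within
  \<open>e / 2\<close> of integrals that differ by less than \<open>e / 2\<close> and enclose the
  integral of \<open>g\<close>.\<close>

lemma has_riemann_integral_straddle:
  fixes g :: "'a::euclidean_space \<Rightarrow> real"
  assumes straddle: "\<And>e. e > 0 \<Longrightarrow> \<exists>l u. continuous_on (cbox a b) l \<and> continuous_on (cbox a b) u \<and>
      (\<forall>x\<in>cbox a b. l x \<le> g x \<and> g x \<le> u x) \<and> integral (cbox a b) (\<lambda>x. u x - l x) < e"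
  shows "has_riemann_integral g (integral (cbox a b) g) (cbox a b)"
proof -
  have *: "\<exists>l u. continuous_on (cbox a b) l \<and> continuous_on (cbox a b) u \<and>
      (\<forall>x\<in>cbox a b. l x \<le> g x \<and> g x \<le> u x) \<and>
      integral (cbox a b) u - integral (cbox a b) l < e \<and>
      integral (cbox a b) l \<le> integral (cbox a b) u" if e: "e > 0" for e
  proof -
    obtain l u where lu: "continuous_on (cbox a b) l" "continuous_on (cbox a b) u"
      "\<forall>x\<in>cbox a b. l x \<le> g x \<and> g x \<le> u x" "integral (cbox a b) (\<lambda>x. u x - l x) < e"
      using straddle[OF e] by blast
    moreover have "integral (cbox a b) (\<lambda>x. u x - l x) = integral (cbox a b) u - integral (cbox a b) l"
      using lu by (intro integral_diff integrable_continuous) auto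
    moreover have "integral (cbox a b) l \<le> integral (cbox a b) u"
      using lu by (intro integral_le integrable_continuous) (auto intro: order_trans)
    ultimately show ?thesis
      by auto
  qed
  have int: "g integrable_on cbox a b"
  proof (rule integrable_straddle_interval)
    fix e :: real
    assume "e > 0"
    then obtain l u where lu: "continuous_on (cbox a b) l" "continuous_on (cbox a b) u"
      "\<forall>x\<in>cbox a b. l x \<le> g x \<and> g x \<le> u x"
      "integral (cbox a b) u - integral (cbox a b) l < e"
      "integral (cbox a b) l \<le> integral (cbox a b) u"
      using * by meson
    then have "(l has_integral integral (cbox a b) l) (cbox a b)"
      "(u has_integral integral (cbox a b) u) (cbox a b)"
      "\<bar>integral (cbox a b) l - integral (cbox a b) u\<bar> < e"
      by (auto intro: integrable_integral integrable_continuous)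
    with lu show "\<exists>l u i j. (l has_integral i) (cbox a b) \<and> (u has_integral j) (cbox a b) \<and>
        \<bar>i - j\<bar> < e \<and> (\<forall>x\<in>cbox a b. l x \<le> g x \<and> g x \<le> u x)"
      by blast
  qed
  show ?thesis
    unfolding has_riemann_integral_def
  proof (intro allI impI)
    fix e :: real
    assume "e > 0"
    then have e2: "e / 2 > 0"
      by simp
    obtain l u where lu: "continuous_on (cbox a b) l" "continuous_on (cbox a b) u"
      "\<And>x. x \<in> cbox a b \<Longrightarrow> l x \<le> g x" "\<And>x. x \<in> cbox a b \<Longrightarrow> g x \<le> u x"
      "integral (cbox a b) u - integral (cbox a b) l < e / 2"
      using *[OF e2] by meson
    have I: "integral (cbox a b) l \<le> integral (cbox a b) g" "integral (cbox a b) g \<le> integral (cbox a b) u"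
      using lu int by (auto intro!: integral_le integrable_continuous)
    obtain d1 where d1: "d1 > 0"
      "\<And>p. \<lbrakk>p tagged_division_of cbox a b; \<forall>(x, K)\<in>p. diameter K < d1\<rbrakk> \<Longrightarrow>
         \<bar>(\<Sum>(x, K)\<in>p. measure lborel K * l x) - integral (cbox a b) l\<bar> < e / 2"
      using has_riemann_integral_continuous[OF lu(1)] e2 unfolding has_riemann_integral_def by meson
    obtain d2 where d2: "d2 > 0"
      "\<And>p. \<lbrakk>p tagged_division_of cbox a b; \<forall>(x, K)\<in>p. diameter K < d2\<rbrakk> \<Longrightarrow>
         \<bar>(\<Sum>(x, K)\<in>p. measure lborel K * u x) - integral (cbox a b) u\<bar> < e / 2"
      using has_riemann_integral_continuous[OF lu(2)] e2 unfolding has_riemann_integral_def by meson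
    have "\<bar>(\<Sum>(x, K)\<in>p. measure lborel K * g x) - integral (cbox a b) g\<bar> < e"
      if p: "p tagged_division_of cbox a b" "\<forall>(x, K)\<in>p. diameter K < min d1 d2" for p
    proof -
      have "\<forall>(x, K)\<in>p. diameter K < d1" "\<forall>(x, K)\<in>p. diameter K < d2"
        using p(2) by auto
      note sums = d1(2)[OF p(1) this(1)] d2(2)[OF p(1) this(2)]
      have tag: "x \<in> cbox a b" if "(x, K) \<in> p" for x K
        using tag_in_interval[OF p(1) that] .
      have "(\<Sum>(x, K)\<in>p. measure lborel K * l x) \<le> (\<Sum>(x, K)\<in>p. measure lborel K * g x)"
        "(\<Sum>(x, K)\<in>p. measure lborel K * g x) \<le> (\<Sum>(x, K)\<in>p. measure lborel K * u x)"
        using lu(3,4) tag by (auto intro!: sum_mono mult_left_mono)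
      with sums I lu(5) show ?thesis
        unfolding abs_less_iff by linarith
    qed
    then show "\<exists>d>0. \<forall>p. p tagged_division_of cbox a b \<and> (\<forall>(x, K)\<in>p. diameter K < d) \<longrightarrow>
        \<bar>(\<Sum>(x, K)\<in>p. measure lborel K * g x) - integral (cbox a b) g\<bar> < e"
      using d1(1) d2(1) by (intro exI[of _ "min d1 d2"]) auto
  qed
qed

section \<open>The one-dimensional estimate along a segment\<close>

text \<open>Without zeros \<open>g'\<close> has constant sign, so the integrand is, up to that sign,
  the derivative of \<open>\<Psi> \<circ> g\<close>. The left end point may be a zero, so that the
  lemma applies to a stretch starting at one.\<close>

lemma integral_abs_deriv_no_zero:
  fixes g g' :: "real \<Rightarrow> real"
  assumes le: "\<alpha> \<le> \<beta>"
    and g: "\<And>t. t \<in> {\<alpha>..\<beta>} \<Longrightarrow> (g has_real_derivative g' t) (at t within {\<alpha>..\<beta>})"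
    and g': "continuous_on {\<alpha>..\<beta>} g'"
    and nz: "\<And>t. t \<in> {\<alpha><..\<beta>} \<Longrightarrow> g' t \<noteq> 0"
    and \<Psi>: "\<And>y. (\<Psi> has_real_derivative \<psi> y) (at y)"
  shows "integral {\<alpha>..\<beta>} (\<lambda>t. \<bar>g' t\<bar> * \<psi> (g t)) \<le> \<bar>\<Psi> (g \<beta>) - \<Psi> (g \<alpha>)\<bar>"
proof -
  \<comment> \<open>A change of sign between \<open>t\<close> and \<open>\<beta>\<close> would
    produce a zero by the intermediate value theorem.\<close>
  have sgn: "g' t * g' \<beta> > 0" if t: "t \<in> {\<alpha><..\<beta>}" for t
  proof (rule ccontr)
    assume "\<not> g' t * g' \<beta> > 0"
    then have "g' t \<le> 0 \<and> 0 \<le> g' \<beta> \<or> g' \<beta> \<le> 0 \<and> 0 \<le> g' t"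
      by (auto simp: not_less mult_le_0_iff)
    moreover have "continuous_on {t..\<beta>} g'"
      using t by (intro continuous_on_subset[OF g']) auto
    ultimately obtain s where "t \<le> s" "s \<le> \<beta>" "g' s = 0"
      using IVT'[of g' t 0 \<beta>] IVT2'[of g' \<beta> 0 t] t by auto
    then show False
      using nz[of s] t by auto
  qed
  define s where "s = sgn (g' \<beta>)"
  have "((\<lambda>t. \<psi> (g t) * g' t) has_integral \<Psi> (g \<beta>) - \<Psi> (g \<alpha>)) {\<alpha>..\<beta>}"
    using le DERIV_chain2[OF \<Psi> g]
    by (intro fundamental_theorem_of_calculus)
       (auto simp: has_real_derivative_iff_has_vector_derivative[symmetric])
  then have "((\<lambda>t. s * (\<psi> (g t) * g' t)) has_integral s * (\<Psi> (g \<beta>) - \<Psi> (g \<alpha>))) {\<alpha>..\<beta>}"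
    by (rule has_integral_mult_right)
  \<comment> \<open>The sign is known only to the right of \<open>\<alpha>\<close>; equality in the
    interior is enough for the integral.\<close>
  moreover have "\<bar>g' t\<bar> * \<psi> (g t) = s * (\<psi> (g t) * g' t)" if "t \<in> box \<alpha> \<beta>" for t
    using sgn[of t] that unfolding s_def by (auto simp: sgn_if abs_if zero_less_mult_iff box_real)
  ultimately have "((\<lambda>t. \<bar>g' t\<bar> * \<psi> (g t)) has_integral s * (\<Psi> (g \<beta>) - \<Psi> (g \<alpha>))) {\<alpha>..\<beta>}"
    using has_integral_spike_interior[of "\<lambda>t. s * (\<psi> (g t) * g' t)" _ \<alpha> \<beta> "\<lambda>t. \<bar>g' t\<bar> * \<psi> (g t)"]
    unfolding cbox_interval by blast
  then have "integral {\<alpha>..\<beta>} (\<lambda>t. \<bar>g' t\<bar> * \<psi> (g t)) = s * (\<Psi> (g \<beta>) - \<Psi> (g \<alpha>))"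
    by (rule integral_unique)
  also have "\<dots> \<le> \<bar>\<Psi> (g \<beta>) - \<Psi> (g \<alpha>)\<bar>"
    unfolding s_def by (auto simp: sgn_if)
  finally show ?thesis .
qed

text \<open>The number of zeros of \<open>g'\<close> does not enter. The term with \<open>D\<close>
  pays for the stretch before the first zero, where only the oscillation of \<open>g\<close> is
  controlled; everything after it is paid for in proportion to length.\<close>

lemma integral_abs_deriv_bound:
  fixes g g' :: "real \<Rightarrow> real"
  assumes le: "\<alpha> \<le> \<beta>"
    and g: "\<And>t. t \<in> {\<alpha>..\<beta>} \<Longrightarrow> (g has_real_derivative g' t) (at t within {\<alpha>..\<beta>})"
    and g': "M-lipschitz_on {\<alpha>..\<beta>} g'" and "M > 0"
    and osc: "\<And>s t. s \<in> {\<alpha>..\<beta>} \<Longrightarrow> t \<in> {\<alpha>..\<beta>} \<Longrightarrow> \<bar>g s - g t\<bar> \<le> D"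
    and \<Psi>: "\<And>y. (\<Psi> has_real_derivative \<psi> y) (at y)" and \<psi>: "continuous_on UNIV \<psi>"
    and hoelder: "\<And>p q. \<bar>\<Psi> p - \<Psi> q\<bar> \<le> K * sqrt \<bar>p - q\<bar>" and "K > 0"
  shows "integral {\<alpha>..\<beta>} (\<lambda>t. \<bar>g' t\<bar> * \<psi> (g t)) \<le> K * (sqrt M * (\<beta> - \<alpha>) + sqrt D)"
proof -
  txt \<open>
    At a zero of \<open>g'\<close> the function \<open>W\<close> below decreases strictly, and away from the zeros of \<open>g'\<close> it
    never exceeds its value at the last zero. Hence the first maximum point of \<open>W\<close> is either \<open>\<alpha>\<close> or
    has no zero of \<open>g'\<close> to its left.
  \<close>
  define h where "h t = \<bar>g' t\<bar> * \<psi> (g t)" for t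
  \<comment> \<open>Over a length d after a zero, \<open>g\<close> varies by at most M d^2, hence
    \<open>\<Psi> \<circ> g\<close> by at most K sqrt(M d^2) = C d.\<close>
  define C where "C = K * sqrt M"
  define W where "W t = integral {\<alpha>..t} h - C * (t - \<alpha>)" for t
  have "C > 0"
    using \<open>M > 0\<close> \<open>K > 0\<close> by (simp add: C_def)
  have cont_g': "continuous_on {\<alpha>..\<beta>} g'"
    using g' by (rule lipschitz_on_continuous_on)
  have cont_g: "continuous_on {\<alpha>..\<beta>} g"
    using g by (rule DERIV_continuous_on)
  have cont_h: "continuous_on {\<alpha>..\<beta>} h"
    unfolding h_def using cont_g cont_g'
    by (intro continuous_intros continuous_on_compose2[OF \<psi>]) auto
  have W': "(W has_real_derivative h t - C) (at t within {\<alpha>..\<beta>})" if "t \<in> {\<alpha>..\<beta>}" for t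
    unfolding W_def using that cont_h
    by (auto intro!: derivative_eq_intros integral_has_real_derivative)
  then have cont_W: "continuous_on {\<alpha>..\<beta>} W"
    by (rule DERIV_continuous_on)
  have "W \<alpha> = 0"
    by (simp add: W_def)
  have "compact {\<alpha>..\<beta>}" "{\<alpha>..\<beta>} \<noteq> {}"
    using le by auto
  then obtain m0 where m0: "m0 \<in> {\<alpha>..\<beta>}" "\<And>t. t \<in> {\<alpha>..\<beta>} \<Longrightarrow> W t \<le> W m0"
    using continuous_attains_sup[OF _ _ cont_W] by blast
  \<comment> \<open>The maximum points of \<open>W\<close>, written as the preimage of a singleton
    so that closedness follows from continuity. Taking the least of them makes \<open>W\<close>
    strictly smaller to its left.\<close>
  define A where "A = {t \<in> {\<alpha>..\<beta>}. W t \<in> {W m0}}"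
  have "closed A"
    unfolding A_def using cont_W by (intro continuous_closed_preimage[unfolded vimage_def Int_def mem_Collect_eq]) auto
  then have "compact ({\<alpha>..\<beta>} \<inter> A)"
    by (rule compact_Int_closed[OF compact_Icc])
  moreover have "{\<alpha>..\<beta>} \<inter> A = A"
    by (auto simp: A_def)
  ultimately have "compact A"
    by simp
  moreover have "A \<noteq> {}"
    using m0 by (auto simp: A_def)
  ultimately obtain m where m: "m \<in> A" "\<And>t. t \<in> A \<Longrightarrow> m \<le> t"
    using compact_attains_inf[of A] by auto
  have m_mem: "m \<in> {\<alpha>..\<beta>}" and m_max: "\<And>t. t \<in> {\<alpha>..\<beta>} \<Longrightarrow> W t \<le> W m"
    using m(1) m0(2) by (auto simp: A_def)
  have m_first: "W t < W m" if "t \<in> {\<alpha>..<m}" for t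
  proof -
    have "t \<notin> A"
      using m(2)[of t] that by auto
    then show ?thesis
      using m_max[of t] m(1) m_mem that by (auto simp: A_def less_le)
  qed
  \<comment> \<open>\<open>z\<close> itself may be a zero of \<open>g'\<close>; below it is either
    \<open>\<alpha>\<close> or the last zero up to \<open>m\<close>.\<close>
  have step: "W m - W z \<le> K * sqrt \<bar>g m - g z\<bar> - C * (m - z)"
    if z: "z \<in> {\<alpha>..m}" and nz: "\<And>t. t \<in> {z<..m} \<Longrightarrow> g' t \<noteq> 0" for z
  proof -
    have "integral {z..m} h \<le> \<bar>\<Psi> (g m) - \<Psi> (g z)\<bar>"
      unfolding h_def
    proof (rule integral_abs_deriv_no_zero[OF _ _ _ nz \<Psi>])
      show "(g has_real_derivative g' t) (at t within {z..m})" if "t \<in> {z..m}" for t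
        using z m_mem that by (intro DERIV_subset[OF g]) auto
    qed (use z m_mem in \<open>auto intro: continuous_on_subset[OF cont_g']\<close>)
    also have "\<dots> \<le> K * sqrt \<bar>g m - g z\<bar>"
      by (rule hoelder)
    finally have "integral {z..m} h \<le> K * sqrt \<bar>g m - g z\<bar>" .
    moreover have "h integrable_on {\<alpha>..m}"
      using m_mem by (intro integrable_continuous_interval continuous_on_subset[OF cont_h]) auto
    then have "integral {\<alpha>..z} h + integral {z..m} h = integral {\<alpha>..m} h"
      using z by (intro Henstock_Kurzweil_Integration.integral_combine) auto
    ultimately show ?thesis
      by (simp add: W_def algebra_simps)
  qed
  have "W m \<le> K * sqrt D"
  proof (cases "\<exists>z\<in>{\<alpha>..m}. g' z = 0")
    case False
    then have "W m - W \<alpha> \<le> K * sqrt \<bar>g m - g \<alpha>\<bar> - C * (m - \<alpha>)"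
      using m_mem by (intro step) auto
    also have "\<dots> \<le> K * sqrt \<bar>g m - g \<alpha>\<bar>"
      using \<open>C > 0\<close> m_mem by simp
    also have "\<dots> \<le> K * sqrt D"
      using osc[of m \<alpha>] m_mem \<open>K > 0\<close> by auto
    finally show ?thesis
      using \<open>W \<alpha> = 0\<close> by simp
  next
    case True
    define Z where "Z = {t \<in> {\<alpha>..m}. g' t \<in> {0}}"
    have "closed Z"
      unfolding Z_def using m_mem
      by (intro continuous_closed_preimage[unfolded vimage_def Int_def mem_Collect_eq]
            continuous_on_subset[OF cont_g']) auto
    then have "compact ({\<alpha>..m} \<inter> Z)"
      by (rule compact_Int_closed[OF compact_Icc])
  moreover have "{\<alpha>..m} \<inter> Z = Z"
      by (auto simp: Z_def)
  ultimately have "compact Z"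
      by simp
    moreover have "Z \<noteq> {}"
      using True by (auto simp: Z_def)
    ultimately obtain z where z: "z \<in> Z" "\<And>t. t \<in> Z \<Longrightarrow> t \<le> z"
      using compact_attains_sup[of Z] by auto
    have z_mem: "z \<in> {\<alpha>..m}" and "g' z = 0"
      using z by (auto simp: Z_def)
    show ?thesis
    proof (cases "z = m")
      case True
      \<comment> \<open>The integrand vanishes at \<open>m\<close>, so \<open>W\<close> has slope
        \<open>- C\<close> there and exceeds \<open>W m\<close> just to the left. This contradicts
        maximality unless there is no room to the left, that is,
        \<open>m = \<alpha>\<close>.\<close>
      have "(W has_real_derivative - C) (at m within {\<alpha>..\<beta>})"
        using W'[OF m_mem] \<open>g' z = 0\<close> True by (simp add: h_def)
      then obtain d where d: "d > 0" "\<And>h. \<lbrakk>0 < h; m - h \<in> {\<alpha>..\<beta>}; h < d\<rbrakk> \<Longrightarrow> W m < W (m - h)"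
        using has_real_derivative_neg_dec_left[of W "- C"] \<open>C > 0\<close> by (metis neg_less_0_iff_less)
      have "m = \<alpha>"
      proof (rule ccontr)
        assume "m \<noteq> \<alpha>"
        define h where "h = min (d / 2) (m - \<alpha>)"
        have "0 < h" "h < d" "m - h \<in> {\<alpha>..\<beta>}"
          using d(1) m_mem \<open>m \<noteq> \<alpha>\<close> by (auto simp: h_def min_def)
        with d(2) m_max show False
          by force
      qed
      \<comment> \<open>The oscillation bound at equal arguments gives
        \<open>D \<ge> 0\<close>.\<close>
      then show ?thesis
        using \<open>W \<alpha> = 0\<close> \<open>K > 0\<close> osc[of \<alpha> \<alpha>] le by simp
    next
      case False
      then have "z < m"
        using z_mem by simp
      \<comment> \<open>Since \<open>g' z = 0\<close>, the Lipschitz bound gives a derivative of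
        size at most \<open>M * (m - z)\<close> on the whole stretch.\<close>
      have "\<bar>g m - g z\<bar> \<le> M * (m - z) * (m - z)"
      proof -
        have "norm (g m - g z) \<le> M * (m - z) * norm (m - z)"
        proof (rule field_differentiable_bound[of "{z..m}"])
          show "(g has_field_derivative g' t) (at t within {z..m})" if "t \<in> {z..m}" for t
            using z_mem m_mem that by (intro DERIV_subset[OF g]) auto
          show "norm (g' t) \<le> M * (m - z)" if "t \<in> {z..m}" for t
          proof -
            have "\<bar>g' t - g' z\<bar> \<le> M * \<bar>t - z\<bar>"
              using lipschitz_onD[OF g', of t z] that z_mem m_mem by (auto simp: dist_real_def)
            also have "\<dots> \<le> M * (m - z)"
              using that \<open>M > 0\<close> by auto
            finally show ?thesis
              using \<open>g' z = 0\<close> by simp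
          qed
        qed (use \<open>z < m\<close> in auto)
        then show ?thesis
          using \<open>z < m\<close> by simp
      qed
      then have "sqrt \<bar>g m - g z\<bar> \<le> sqrt (M * (m - z)\<^sup>2)"
        by (intro real_sqrt_le_mono) (simp add: power2_eq_square)
      also have "\<dots> = sqrt M * (m - z)"
        using \<open>z < m\<close> by (simp add: real_sqrt_mult)
      finally have "K * sqrt \<bar>g m - g z\<bar> \<le> C * (m - z)"
        using \<open>K > 0\<close> by (simp add: C_def mult.assoc)
      moreover have "W m - W z \<le> K * sqrt \<bar>g m - g z\<bar> - C * (m - z)"
      proof (rule step[OF z_mem])
        show "g' t \<noteq> 0" if "t \<in> {z<..m}" for t
          using z(2)[of t] z_mem that by (auto simp: Z_def)
      qed
      \<comment> \<open>Together these give \<open>W m \<le> W z\<close>, contradicting that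
        \<open>m\<close> is the first maximum point; this case cannot occur.\<close>
      ultimately show ?thesis
        using m_first[of z] z_mem \<open>z < m\<close> by simp
    qed
  qed
  moreover have "W \<beta> \<le> W m"
    using m_max le by auto
  ultimately have "integral {\<alpha>..\<beta>} h - C * (\<beta> - \<alpha>) \<le> K * sqrt D"
    by (simp add: W_def)
  then show ?thesis
    unfolding h_def C_def by (simp add: algebra_simps)
qed

text \<open>The odd primitive is explicit. On either side of 0 subadditivity of the square root
  gives the constant 2; arguments of opposite signs double it. Neither constant nor exponent depends
  on \<open>e\<close>.\<close>

lemma sqrt_primitive:
  fixes e :: real
  assumes "e > 0"
  obtains \<Psi> where "\<And>y. (\<Psi> has_real_derivative 1 / sqrt (\<bar>y\<bar> + e)) (at y)"
    "\<And>p q. \<bar>\<Psi> p - \<Psi> q\<bar> \<le> 4 * sqrt \<bar>p - q\<bar>"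
proof
  define \<Psi> where "\<Psi> y = 2 * sgn y * (sqrt (\<bar>y\<bar> + e) - sqrt e)" for y
  show "(\<Psi> has_real_derivative 1 / sqrt (\<bar>y\<bar> + e)) (at y)" for y
  proof -
    consider "y > 0" | "y < 0" | "y = 0"
      by linarith
    then show ?thesis
    proof cases
      case 1
      have "((\<lambda>y. 2 * (sqrt (y + e) - sqrt e)) has_real_derivative 1 / sqrt (\<bar>y\<bar> + e)) (at y)"
        using 1 assms by (auto intro!: derivative_eq_intros simp: field_simps)
      then show ?thesis
        by (rule has_field_derivative_transform_within_open[of _ _ _ "{0<..}"])
           (use 1 in \<open>auto simp: \<Psi>_def\<close>)
    next
      case 2
      have "((\<lambda>y. - 2 * (sqrt (- y + e) - sqrt e)) has_real_derivative 1 / sqrt (\<bar>y\<bar> + e)) (at y)"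
        using 2 assms by (auto intro!: derivative_eq_intros simp: field_simps)
      then show ?thesis
        by (rule has_field_derivative_transform_within_open[of _ _ _ "{..<0}"])
           (use 2 in \<open>auto simp: \<Psi>_def\<close>)
    next
      case 3
      \<comment> \<open>At 0 the two branches of \<open>\<Psi>\<close> meet. Rationalizing the
        difference of roots gives \<open>\<Psi> y = \<phi> y * y\<close> with \<open>\<phi>\<close>
        continuous, and Caratheodory's criterion yields the derivative
        \<open>\<phi> 0\<close>.\<close>
      define \<phi> where "\<phi> y = 2 / (sqrt (\<bar>y\<bar> + e) + sqrt e)" for y
      have pos: "sqrt (\<bar>y\<bar> + e) + sqrt e > 0" for y
        using assms by (intro add_nonneg_pos) auto
      have "\<Psi> y - \<Psi> 0 = \<phi> y * (y - 0)" for y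
      proof -
        have "(sqrt (\<bar>y\<bar> + e) - sqrt e) * (sqrt (\<bar>y\<bar> + e) + sqrt e) = \<bar>y\<bar>"
          using assms by (simp add: algebra_simps)
        then have "sqrt (\<bar>y\<bar> + e) - sqrt e = \<bar>y\<bar> / (sqrt (\<bar>y\<bar> + e) + sqrt e)"
          using pos[of y] by (simp add: field_simps)
        then show ?thesis
          by (simp add: \<Psi>_def \<phi>_def sgn_if)
      qed
      moreover have "isCont \<phi> 0"
        unfolding \<phi>_def using assms by (intro continuous_intros) auto
      moreover have "\<phi> 0 = 1 / sqrt (\<bar>y\<bar> + e)"
        using 3 by (simp add: \<phi>_def)
      ultimately show ?thesis
        using 3 CARAT_DERIV by blast
    qed
  qed
  have *: "\<bar>\<Psi> p - \<Psi> q\<bar> \<le> 4 * sqrt \<bar>p - q\<bar>" if "p \<le> q" for p q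
  proof -
    have sub: "sqrt (v + e) \<le> sqrt (u + e) + sqrt (v - u)" "sqrt (u + e) \<le> sqrt (v + e)"
      if "0 \<le> u" "u \<le> v" for u v
      using sqrt_add_le_add_sqrt[of "u + e" "v - u"] that assms by (auto simp: add.commute)
    consider "0 \<le> p" | "q \<le> 0" | "p < 0" "0 < q"
      by linarith
    then show ?thesis
    proof cases
      case 1
      have "\<Psi> y = 2 * (sqrt (y + e) - sqrt e)" if "y \<ge> 0" for y
        using that by (simp add: \<Psi>_def sgn_if)
      then have "\<bar>\<Psi> p - \<Psi> q\<bar> = 2 * (sqrt (q + e) - sqrt (p + e))"
        using sub[of p q] 1 that by simp
      also have "\<dots> \<le> 2 * sqrt (q - p)"
        using sub(1)[of "p" "q"] 1 that by simp
      also have "\<dots> \<le> 4 * sqrt \<bar>p - q\<bar>"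
        using that by simp
      finally show ?thesis .
    next
      case 2
      have "\<Psi> y = - 2 * (sqrt (- y + e) - sqrt e)" if "y \<le> 0" for y
        using that by (simp add: \<Psi>_def sgn_if)
      then have "\<bar>\<Psi> p - \<Psi> q\<bar> = 2 * (sqrt (- p + e) - sqrt (- q + e))"
        using sub[of "- q" "- p"] 2 that by simp
      also have "\<dots> \<le> 2 * sqrt (q - p)"
        using sub(1)[of "- q" "- p"] 2 that by simp
      also have "\<dots> \<le> 4 * sqrt \<bar>p - q\<bar>"
        using that by simp
      finally show ?thesis .
    next
      case 3
      \<comment> \<open>The difference splits at 0 into two one-sided terms, each at most
        \<open>2 * sqrt (q - p)\<close>.\<close>
      have "\<Psi> q = 2 * (sqrt (q + e) - sqrt e)" "\<Psi> p = - 2 * (sqrt (- p + e) - sqrt e)"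
        using 3 by (simp_all add: \<Psi>_def)
      moreover have "sqrt q \<le> sqrt (q - p)" "sqrt (- p) \<le> sqrt (q - p)"
        using 3 by auto
      moreover have "sqrt (q + e) \<le> sqrt e + sqrt q" "sqrt (- p + e) \<le> sqrt e + sqrt (- p)"
        "sqrt e \<le> sqrt (q + e)" "sqrt e \<le> sqrt (- p + e)"
        using sub[of 0 q] sub[of 0 "- p"] 3 by auto
      ultimately have "\<bar>\<Psi> p - \<Psi> q\<bar> \<le> 4 * sqrt (q - p)"
        by (smt (verit))
      then show ?thesis
        using 3 by simp
    qed
  qed
  show "\<bar>\<Psi> p - \<Psi> q\<bar> \<le> 4 * sqrt \<bar>p - q\<bar>" for p q
    using *[of p q] *[of q p] by (cases "p \<le> q") (auto simp: abs_minus_commute)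
qed

section \<open>From segments to the cube\<close>

text \<open>Averaging over the translations by \<open>t u\<close> with \<open>0 \<le> t \<le> 1\<close> avoids splitting off a coordinate.\<close>

lemma integral_le_of_line_integrals:
  fixes h :: "'a::euclidean_space \<Rightarrow> real"
  assumes cont: "continuous_on (cbox a b) h" and nonneg: "\<And>x. x \<in> cbox a b \<Longrightarrow> 0 \<le> h x"
    and u: "norm u \<le> 1" and r: "cbox a b \<subseteq> cball 0 r" and "0 \<le> C"
    and line: "\<And>x \<alpha> \<beta>. \<lbrakk>\<alpha> \<le> \<beta>; \<beta> - \<alpha> \<le> 1; \<And>t. t \<in> {\<alpha>..\<beta>} \<Longrightarrow> x + t *\<^sub>R u \<in> cbox a b\<rbrakk> \<Longrightarrow>
        integral {\<alpha>..\<beta>} (\<lambda>t. h (x + t *\<^sub>R u)) \<le> C"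
  shows "integral (cbox a b) h \<le> C * measure lborel (cball (0::'a) (r + 1))"
proof -
  \<comment> \<open>Extension by zero makes all translations meaningful, and values in
    \<open>ennreal\<close> allow the order of integration to be exchanged.\<close>
  define H where "H x = ennreal (indicator (cbox a b) x * h x)" for x
  have H_meas [measurable]: "H \<in> borel_measurable borel"
    using borel_measurable_continuous_on_indicator[OF _ cont] unfolding H_def by simp
  have "(h has_integral integral (cbox a b) h) (cbox a b)"
    using cont by (intro integrable_integral integrable_continuous)
  then have int: "(\<integral>\<^sup>+x. H x \<partial>lborel) = ennreal (integral (cbox a b) h)"
    unfolding H_def by (intro nn_integral_has_integral_lebesgue nonneg)
  \<comment> \<open>For fixed \<open>x\<close> the admissible parameters form a compact convex set,
    hence one interval of length at most 1, to which \<open>line\<close> applies. It is empty unless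
    \<open>x\<close> is within distance 1 of the box; hence the radius \<open>r + 1\<close>.\<close>
  have inner: "(\<integral>\<^sup>+t. indicator {0..1} t * H (t *\<^sub>R u + x) \<partial>lborel)
      \<le> ennreal C * indicator (cball 0 (r + 1)) x" for x
  proof -
    define S where "S = {t \<in> {0..1::real}. x + t *\<^sub>R u \<in> cbox a b}"
    have S_eq: "S = {0..1} \<inter> (\<lambda>t. x + t *\<^sub>R u) -` cbox a b"
      by (auto simp: S_def)
    have "closed ((\<lambda>t::real. x + t *\<^sub>R u) -` cbox a b)"
      by (intro continuous_closed_vimage closed_cbox) (intro continuous_intros)
    then have "compact S"
      by (simp add: S_eq compact_Int_closed)
    moreover have "convex S"
    proof -
      have "(\<lambda>t::real. x + t *\<^sub>R u) -` cbox a b = (\<lambda>t. t *\<^sub>R u) -` ((\<lambda>y. y - x) ` cbox a b)"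
        by (force simp: image_iff algebra_simps)
      moreover have "convex ((\<lambda>t. t *\<^sub>R u) -` ((\<lambda>y. y - x) ` cbox a b))"
        by (intro convex_linear_vimage convex_translation_subtract convex_box linear_scaleR_left)
      ultimately show ?thesis
        using S_eq by (simp add: convex_Int)
    qed
    ultimately obtain \<alpha> \<beta> where S: "S = {\<alpha>..\<beta>}"
      by (metis is_interval_convex_1 is_interval_compact cbox_interval)
    have eq: "indicator {0..1} t * H (t *\<^sub>R u + x) = ennreal (indicator S t * h (x + t *\<^sub>R u))" for t
      by (auto simp: S_def H_def indicator_def add.commute)
    show ?thesis
    proof (cases "\<alpha> \<le> \<beta>")
      case True
      have "\<beta> - \<alpha> \<le> 1"
      proof -
        have "\<alpha> \<in> S" "\<beta> \<in> S"
          using S True by auto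
        then show ?thesis
          by (auto simp: S_def)
      qed
      have mem: "x + t *\<^sub>R u \<in> cbox a b" if "t \<in> {\<alpha>..\<beta>}" for t
      proof -
        have "t \<in> S"
          using that S by simp
        then show ?thesis
          by (simp add: S_def)
      qed
      have "continuous_on {\<alpha>..\<beta>} (\<lambda>t. h (x + t *\<^sub>R u))"
        using mem by (intro continuous_on_compose2[OF cont] continuous_intros) auto
      then have "((\<lambda>t. h (x + t *\<^sub>R u)) has_integral integral {\<alpha>..\<beta>} (\<lambda>t. h (x + t *\<^sub>R u))) S"
        unfolding S by (intro integrable_integral integrable_continuous_interval)
      then have "(\<integral>\<^sup>+t. indicator {0..1} t * H (t *\<^sub>R u + x) \<partial>lborel)
          = ennreal (integral {\<alpha>..\<beta>} (\<lambda>t. h (x + t *\<^sub>R u)))"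
        unfolding eq using mem S nonneg by (intro nn_integral_has_integral_lebesgue) auto
      also have "\<dots> \<le> ennreal C"
        using True \<open>\<beta> - \<alpha> \<le> 1\<close> mem by (intro ennreal_leI line) auto
      also have "x \<in> cball 0 (r + 1)"
      proof -
        have "x + \<alpha> *\<^sub>R u \<in> cball 0 r" "\<alpha> \<in> S"
          using mem[of \<alpha>] True r S by auto
        then have "norm (x + \<alpha> *\<^sub>R u) \<le> r" "\<bar>\<alpha>\<bar> \<le> 1"
          by (auto simp: S_def)
        moreover have "norm (\<alpha> *\<^sub>R u) \<le> 1"
          using \<open>\<bar>\<alpha>\<bar> \<le> 1\<close> u by (simp add: mult_le_one)
        ultimately show ?thesis
          using norm_triangle_ineq4[of "x + \<alpha> *\<^sub>R u" "\<alpha> *\<^sub>R u"] by simp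
      qed
      ultimately show ?thesis
        by simp
    next
      case False
      then have "S = {}"
        using S by simp
      then show ?thesis
        unfolding eq by simp
    qed
  qed
  \<comment> \<open>The unit interval has measure 1, so averaging over \<open>t\<close> changes
    nothing; each translate has the same integral by invariance of Lebesgue measure.\<close>
  have "(\<integral>\<^sup>+x. H x \<partial>lborel) = (\<integral>\<^sup>+t. indicator {0..1::real} t * (\<integral>\<^sup>+x. H x \<partial>lborel) \<partial>lborel)"
    by (simp add: nn_integral_multc)
  also have "\<dots> = (\<integral>\<^sup>+t. (\<integral>\<^sup>+x. indicator {0..1::real} t * H (t *\<^sub>R u + x) \<partial>lborel) \<partial>lborel)"
  proof (intro nn_integral_cong)
    fix t :: real
    have "(\<integral>\<^sup>+x. H x \<partial>lborel) = (\<integral>\<^sup>+x. H x \<partial>distr lborel borel ((+) (t *\<^sub>R u)))"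
      by (simp add: lborel_distr_plus)
    also have "\<dots> = (\<integral>\<^sup>+x. H (t *\<^sub>R u + x) \<partial>lborel)"
      by (intro nn_integral_distr) auto
    finally show "indicator {0..1} t * (\<integral>\<^sup>+x. H x \<partial>lborel)
        = (\<integral>\<^sup>+x. indicator {0..1} t * H (t *\<^sub>R u + x) \<partial>lborel)"
      by (simp add: nn_integral_cmult)
  qed
  also have "\<dots> = (\<integral>\<^sup>+x. (\<integral>\<^sup>+t. indicator {0..1::real} t * H (t *\<^sub>R u + x) \<partial>lborel) \<partial>lborel)"
    by (intro lborel_pair.Fubini') measurable
  also have "\<dots> \<le> (\<integral>\<^sup>+x. ennreal C * indicator (cball (0::'a) (r + 1)) x \<partial>lborel)"
    by (intro nn_integral_mono inner)
  also have "\<dots> = ennreal C * emeasure lborel (cball (0::'a) (r + 1))"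
    by (simp add: nn_integral_cmult_indicator)
  also have "\<dots> = ennreal (C * measure lborel (cball (0::'a) (r + 1)))"
    using \<open>0 \<le> C\<close> emeasure_lborel_cball_finite[of "0::'a" "r + 1"]
    by (subst emeasure_eq_ennreal_measure) (auto simp: ennreal_mult)
  finally show ?thesis
    unfolding int using \<open>0 \<le> C\<close> by (subst (asm) ennreal_le_iff) auto
qed

text \<open>\<open>partial_deriv\<close> is a \<open>deriv\<close> at 0 and is informative only once
  the restriction to the line is differentiable. The chain rule gives this, and a shift of the
  parameter moves the base point to \<open>t\<close>.\<close>

lemma has_real_derivative_partial_deriv:
  fixes g :: "real ^ 'n \<Rightarrow> real"
  assumes "g differentiable (at (x + t *\<^sub>R axis i 1))"
  shows "((\<lambda>t. g (x + t *\<^sub>R axis i 1)) has_real_derivative partial_deriv i g (x + t *\<^sub>R axis i 1)) (at t)"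
proof -
  let ?y = "x + t *\<^sub>R axis i 1"
  have "(g \<circ> (\<lambda>s. ?y + s *\<^sub>R axis i 1)) differentiable (at 0)"
    using assms by (intro differentiable_chain_at) auto
  then have "((\<lambda>s. g (?y + s *\<^sub>R axis i 1)) has_real_derivative partial_deriv i g ?y) (at 0)"
    unfolding partial_deriv_def by (simp add: o_def DERIV_deriv_iff_real_differentiable)
  then show ?thesis
    using DERIV_shift[of "\<lambda>t. g (x + t *\<^sub>R axis i 1)" _ 0 t]
    by (simp add: scaleR_add_left add.assoc add.commute add.left_commute)
qed

text \<open>The Euclidean norm is at most the sum of the absolute values of the coordinates, so each
  partial derivative is treated along its own axis. \<open>C\<close> is chosen before
  \<open>c\<close> and \<open>e\<close>.\<close>

lemma grad_over_sqrt_bound: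
  fixes \<sigma> :: "real ^ 'n \<Rightarrow> real"
  assumes sub: "cbox a b \<subseteq> Q1" and diff: "\<sigma> twice_differentiable_on Q1"
    and second: "\<And>x i j. x \<in> Q1 \<Longrightarrow> \<bar>partial_deriv j (partial_deriv i \<sigma>) x\<bar> \<le> M"
    and \<sigma>_le: "\<And>x. x \<in> cbox a b \<Longrightarrow> \<bar>\<sigma> x\<bar> \<le> 1"
  shows "\<exists>C>0. \<forall>c e. e > 0 \<longrightarrow>
      integral (cbox a b) (\<lambda>x. norm (grad \<sigma> x) / sqrt (\<bar>\<sigma> x - c\<bar> + e)) \<le> C"
proof -
  \<comment> \<open>The Lipschitz constant has to be positive, while \<open>M\<close> may be
    0.\<close>
  define M' where "M' = max M 1"
  have "M' > 0" and M': "\<And>x i j. x \<in> Q1 \<Longrightarrow> \<bar>partial_deriv j (partial_deriv i \<sigma>) x\<bar> \<le> M'"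
    using second by (simp_all add: M'_def le_max_iff_disj)
  \<comment> \<open>Here 4 is the Hoelder constant of \<open>\<Psi>\<close>, 2 bounds the
    oscillation of \<open>\<sigma>\<close>, and the segments have length at most 1.\<close>
  define L where "L = 4 * (sqrt M' + sqrt 2)"
  have "L > 0"
    using \<open>M' > 0\<close> by (simp add: L_def add_pos_pos)
  obtain r where r: "cbox a b \<subseteq> cball 0 r"
    using bounded_subset_ballD[OF bounded_cbox, of a b 0] ball_subset_cball by blast
  have cont_\<sigma>: "continuous_on (cbox a b) \<sigma>" and cont_grad: "continuous_on (cbox a b) (grad \<sigma>)"
    using diff sub unfolding twice_differentiable_on_def
    by (auto intro!: continuous_at_imp_continuous_on differentiable_imp_continuous_within)
  have diff1: "\<sigma> differentiable (at x)" and diff2: "partial_deriv i \<sigma> differentiable (at x)"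
    if "x \<in> cbox a b" for x i
  proof -
    show "\<sigma> differentiable (at x)"
      using diff sub that by (auto simp: twice_differentiable_on_def)
    have "(\<lambda>x. grad \<sigma> x $ i) differentiable (at x)"
      using diff sub that unfolding twice_differentiable_on_def differentiable_def
      by (blast intro: bounded_linear.has_derivative[OF bounded_linear_vec_nth])
    then show "partial_deriv i \<sigma> differentiable (at x)"
      by (simp add: grad_def)
  qed
  have comp: "integral (cbox a b) (\<lambda>x. \<bar>grad \<sigma> x $ i\<bar> * (1 / sqrt (\<bar>\<sigma> x - c\<bar> + e)))
      \<le> L * measure lborel (cball (0::real^'n) (r + 1))" if "e > 0" for i c e
  proof (rule integral_le_of_line_integrals[where u = "axis i 1", OF _ _ _ r])
    show "continuous_on (cbox a b) (\<lambda>x. \<bar>grad \<sigma> x $ i\<bar> * (1 / sqrt (\<bar>\<sigma> x - c\<bar> + e)))"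
      using that cont_\<sigma> cont_grad by (intro continuous_intros) auto
    fix x :: "real^'n" and \<alpha> \<beta> :: real
    assume le: "\<alpha> \<le> \<beta>" "\<beta> - \<alpha> \<le> 1"
      and mem: "\<And>t. t \<in> {\<alpha>..\<beta>} \<Longrightarrow> x + t *\<^sub>R axis i 1 \<in> cbox a b"
    obtain \<Psi> where \<Psi>: "\<And>y. (\<Psi> has_real_derivative 1 / sqrt (\<bar>y\<bar> + e)) (at y)"
      "\<And>p q. \<bar>\<Psi> p - \<Psi> q\<bar> \<le> 4 * sqrt \<bar>p - q\<bar>"
      using sqrt_primitive[OF \<open>e > 0\<close>] by blast
    have "integral {\<alpha>..\<beta>} (\<lambda>t. \<bar>partial_deriv i \<sigma> (x + t *\<^sub>R axis i 1)\<bar> *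
          (1 / sqrt (\<bar>\<sigma> (x + t *\<^sub>R axis i 1) - c\<bar> + e)))
        \<le> 4 * (sqrt M' * (\<beta> - \<alpha>) + sqrt 2)"
    proof (rule integral_abs_deriv_bound[where g = "\<lambda>t. \<sigma> (x + t *\<^sub>R axis i 1)"
          and \<psi> = "\<lambda>y. 1 / sqrt (\<bar>y - c\<bar> + e)" and \<Psi> = "\<lambda>y. \<Psi> (y - c)"])
      show "((\<lambda>t. \<sigma> (x + t *\<^sub>R axis i 1)) has_real_derivative
          partial_deriv i \<sigma> (x + t *\<^sub>R axis i 1)) (at t within {\<alpha>..\<beta>})" if "t \<in> {\<alpha>..\<beta>}" for t
        using that mem diff1
        by (intro has_real_derivative_partial_deriv DERIV_subset[of _ _ _ UNIV]) auto
      show "M'-lipschitz_on {\<alpha>..\<beta>} (\<lambda>t. partial_deriv i \<sigma> (x + t *\<^sub>R axis i 1))"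
      proof (rule lipschitz_onI)
        fix s t
        assume st: "s \<in> {\<alpha>..\<beta>}" "t \<in> {\<alpha>..\<beta>}"
        have "norm (partial_deriv i \<sigma> (x + s *\<^sub>R axis i 1) - partial_deriv i \<sigma> (x + t *\<^sub>R axis i 1))
            \<le> M' * norm (s - t)"
        proof (rule field_differentiable_bound[OF _ _ _ st])
          fix z
          assume z: "z \<in> {\<alpha>..\<beta>}"
          show "((\<lambda>t. partial_deriv i \<sigma> (x + t *\<^sub>R axis i 1)) has_field_derivative
              partial_deriv i (partial_deriv i \<sigma>) (x + z *\<^sub>R axis i 1)) (at z within {\<alpha>..\<beta>})"
            using mem[OF z] diff2
            by (intro has_field_derivative_at_within[OF has_real_derivative_partial_deriv]) auto
          show "norm (partial_deriv i (partial_deriv i \<sigma>) (x + z *\<^sub>R axis i 1)) \<le> M'"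
            using M'[of "x + z *\<^sub>R axis i 1"] mem[OF z] sub by auto
        qed simp
        then show "dist (partial_deriv i \<sigma> (x + s *\<^sub>R axis i 1)) (partial_deriv i \<sigma> (x + t *\<^sub>R axis i 1))
            \<le> M' * dist s t"
          by (simp add: dist_norm)
      qed (use \<open>M' > 0\<close> in simp)
      show "\<bar>\<sigma> (x + s *\<^sub>R axis i 1) - \<sigma> (x + t *\<^sub>R axis i 1)\<bar> \<le> 2" if "s \<in> {\<alpha>..\<beta>}" "t \<in> {\<alpha>..\<beta>}" for s t
        using \<sigma>_le[OF mem[OF that(1)]] \<sigma>_le[OF mem[OF that(2)]] by linarith
      show "((\<lambda>y. \<Psi> (y - c)) has_real_derivative 1 / sqrt (\<bar>y - c\<bar> + e)) (at y)" for y
        using DERIV_shift[of \<Psi> _ y "- c"] \<Psi>(1)[of "y - c"] by simp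
      show "continuous_on UNIV (\<lambda>y. 1 / sqrt (\<bar>y - c\<bar> + e))"
        using \<open>e > 0\<close> by (intro continuous_intros) auto
      show "\<bar>\<Psi> (p - c) - \<Psi> (q - c)\<bar> \<le> 4 * sqrt \<bar>p - q\<bar>" for p q
        using \<Psi>(2)[of "p - c" "q - c"] by simp
    qed (use le \<open>M' > 0\<close> in auto)
    also have "\<dots> \<le> L"
      using le \<open>M' > 0\<close> by (simp add: L_def mult_left_le)
    finally show "integral {\<alpha>..\<beta>} (\<lambda>t. \<bar>grad \<sigma> (x + t *\<^sub>R axis i 1) $ i\<bar> *
        (1 / sqrt (\<bar>\<sigma> (x + t *\<^sub>R axis i 1) - c\<bar> + e))) \<le> L"
      by (simp add: grad_def)
  qed (use that \<open>L > 0\<close> in \<open>auto simp: norm_axis_1\<close>)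
  \<comment> \<open>One term per coordinate; the summand 1 secures positivity.\<close>
  define C where "C = CARD('n) * (L * measure lborel (cball (0::real^'n) (r + 1))) + 1"
  have "integral (cbox a b) (\<lambda>x. norm (grad \<sigma> x) / sqrt (\<bar>\<sigma> x - c\<bar> + e)) \<le> C" if "e > 0" for c e
  proof -
    let ?h = "\<lambda>i x. \<bar>grad \<sigma> x $ i\<bar> * (1 / sqrt (\<bar>\<sigma> x - c\<bar> + e))"
    have int: "?h i integrable_on cbox a b" for i
      using that cont_\<sigma> cont_grad by (intro integrable_continuous continuous_intros) auto
    have "integral (cbox a b) (\<lambda>x. norm (grad \<sigma> x) / sqrt (\<bar>\<sigma> x - c\<bar> + e))
        \<le> integral (cbox a b) (\<lambda>x. \<Sum>i\<in>UNIV. ?h i x)"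
    proof (rule integral_le)
      show "(\<lambda>x. norm (grad \<sigma> x) / sqrt (\<bar>\<sigma> x - c\<bar> + e)) integrable_on cbox a b"
        using that cont_\<sigma> cont_grad by (intro integrable_continuous continuous_intros) auto
      show "norm (grad \<sigma> x) / sqrt (\<bar>\<sigma> x - c\<bar> + e) \<le> (\<Sum>i\<in>UNIV. ?h i x)" for x
        using norm_le_l1_cart[of "grad \<sigma> x"] that
        by (simp add: sum_divide_distrib[symmetric] divide_right_mono)
    qed (use int in \<open>intro integrable_sum; simp\<close>)
    also have "\<dots> = (\<Sum>i\<in>UNIV. integral (cbox a b) (?h i))"
      using int by (intro integral_sum) auto
    also have "\<dots> \<le> (\<Sum>i\<in>(UNIV::'n set). L * measure lborel (cball (0::real^'n) (r + 1)))"
      using comp[OF that] by (intro sum_mono)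
    finally show ?thesis
      by (simp add: C_def)
  qed
  moreover have "C > 0"
    using \<open>L > 0\<close> by (auto simp: C_def intro!: add_nonneg_pos)
  ultimately show ?thesis
    by blast
qed

section \<open>Riemann integrability of the truncated integrands\<close>

text \<open>The jump at \<open>\<bar>\<sigma>\<bar> = a\<close> is replaced by two continuous
  cutoffs that differ only in thin layers around it. There the denominator in \<open>bound\<close>
  is small, so the integral of \<open>G\<close> over the layers is small too.\<close>

lemma truncation_straddle:
  fixes \<sigma> G w :: "'a::euclidean_space \<Rightarrow> real"
  assumes \<sigma>: "continuous_on (cbox p q) \<sigma>" and G: "continuous_on (cbox p q) G"
    and w: "continuous_on (cbox p q) w"
    and wG: "\<And>x. x \<in> cbox p q \<Longrightarrow> 0 \<le> w x" "\<And>x. x \<in> cbox p q \<Longrightarrow> w x \<le> B * G x"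
    and "0 \<le> B" "0 < C"
    and bound: "\<And>c e. e > 0 \<Longrightarrow> integral (cbox p q) (\<lambda>x. G x / sqrt (\<bar>\<sigma> x - c\<bar> + e)) \<le> C"
    and "e > 0"
  shows "\<exists>l u. continuous_on (cbox p q) l \<and> continuous_on (cbox p q) u \<and>
      (\<forall>x\<in>cbox p q. l x \<le> (if \<bar>\<sigma> x\<bar> < a then w x else 0) \<and>
        (if \<bar>\<sigma> x\<bar> < a then w x else 0) \<le> u x) \<and> integral (cbox p q) (\<lambda>x. u x - l x) < e"
proof -
  \<comment> \<open>Chosen so that the final bound \<open>B * s * (C + C)\<close> is below
    \<open>e\<close>; the summand 1 covers \<open>B = 0\<close>.\<close>
  define s where "s = e / (2 * B * C + 1)"
  define \<delta> where "\<delta> = s\<^sup>2 / 2"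
  have "2 * B * C \<ge> 0"
    using \<open>0 \<le> B\<close> \<open>0 < C\<close> by simp
  then have "s > 0" and s: "2 * B * C * s < e"
    using \<open>e > 0\<close> by (simp_all add: s_def field_simps)
  have "\<delta> > 0" and sqrt_\<delta>: "sqrt (2 * \<delta>) = s"
    using \<open>s > 0\<close> by (simp_all add: \<delta>_def)
  \<comment> \<open>A continuous cutoff: 1 for
    \<open>\<bar>\<sigma>\<bar> \<le> b - \<delta>\<close>, 0 for
    \<open>\<bar>\<sigma>\<bar> \<ge> b\<close>, linear in between. Taking \<open>b = a\<close> lies
    below the jump, \<open>b = a + \<delta>\<close> above it.\<close>
  define \<phi> where "\<phi> b x = min 1 (max 0 ((b - \<bar>\<sigma> x\<bar>) / \<delta>))" for b x
  define k where "k c x = G x / sqrt (\<bar>\<sigma> x - c\<bar> + \<delta>)" for c x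
  have cont_\<phi>: "continuous_on (cbox p q) (\<phi> b)" for b
    unfolding \<phi>_def using \<sigma> \<open>\<delta> > 0\<close> by (intro continuous_intros) auto
  have cont_k: "continuous_on (cbox p q) (k c)" for c
    unfolding k_def using \<sigma> G \<open>\<delta> > 0\<close> by (intro continuous_intros) auto
  have \<phi>_01: "0 \<le> \<phi> b x" "\<phi> b x \<le> 1" for b x
    by (auto simp: \<phi>_def)
  have \<phi>_0: "\<phi> b x = 0" if "b \<le> \<bar>\<sigma> x\<bar>" for b x
  proof -
    have "(b - \<bar>\<sigma> x\<bar>) / \<delta> \<le> 0"
      using that \<open>\<delta> > 0\<close> by (simp add: divide_nonpos_pos)
    then show ?thesis
      by (simp add: \<phi>_def)
  qed
  have \<phi>_1: "\<phi> b x = 1" if "\<bar>\<sigma> x\<bar> \<le> b - \<delta>" for b x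
  proof -
    have "1 \<le> (b - \<bar>\<sigma> x\<bar>) / \<delta>"
      using that \<open>\<delta> > 0\<close> by (simp add: field_simps)
    then show ?thesis
      by (simp add: \<phi>_def)
  qed
  let ?l = "\<lambda>x. w x * \<phi> a x" and ?u = "\<lambda>x. w x * \<phi> (a + \<delta>) x"
  have cont: "continuous_on (cbox p q) ?l" "continuous_on (cbox p q) ?u"
    using w cont_\<phi> by (auto intro!: continuous_intros)
  have between: "?l x \<le> (if \<bar>\<sigma> x\<bar> < a then w x else 0)" "(if \<bar>\<sigma> x\<bar> < a then w x else 0) \<le> ?u x"
    if x: "x \<in> cbox p q" for x
  proof -
    have "w x * \<phi> a x \<le> w x" "0 \<le> w x * \<phi> (a + \<delta>) x"
      using wG(1)[OF x] \<phi>_01 by (simp_all add: mult_left_le)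
    then show "?l x \<le> (if \<bar>\<sigma> x\<bar> < a then w x else 0)" "(if \<bar>\<sigma> x\<bar> < a then w x else 0) \<le> ?u x"
      using \<phi>_0[of a x] \<phi>_1[of x "a + \<delta>"] by (cases "\<bar>\<sigma> x\<bar> < a"; simp)+
  qed
  have diff: "?u x - ?l x \<le> B * s * (k a x + k (- a) x)" if x: "x \<in> cbox p q" for x
  proof -
    have G0: "0 \<le> B * G x"
      using wG[OF x] by linarith
    have *: "0 \<le> B * s * k c x" for c
    proof -
      have "0 \<le> s * (B * G x) / sqrt (\<bar>\<sigma> x - c\<bar> + \<delta>)"
        using G0 \<open>s > 0\<close> \<open>\<delta> > 0\<close> by simp
      then show ?thesis
        by (simp add: k_def mult_ac)
    qed
    \<comment> \<open>Inside a layer the denominator is at most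
      \<open>sqrt (2 * \<delta>) = s\<close>, so the factor \<open>s\<close> compensates it.\<close>
    have near: "B * G x \<le> B * s * k c x" if c: "\<bar>\<sigma> x - c\<bar> \<le> \<delta>" for c
    proof -
      have "sqrt (\<bar>\<sigma> x - c\<bar> + \<delta>) \<le> s"
        unfolding sqrt_\<delta>[symmetric] using c by simp
      moreover have "sqrt (\<bar>\<sigma> x - c\<bar> + \<delta>) > 0"
        using \<open>\<delta> > 0\<close> by simp
      ultimately have "1 \<le> s / sqrt (\<bar>\<sigma> x - c\<bar> + \<delta>)"
        by simp
      from mult_left_mono[OF this G0] show ?thesis
        by (simp add: k_def mult_ac)
    qed
    \<comment> \<open>Off the layers the cutoffs agree; \<open>\<bar>\<sigma>\<bar>\<close> near
      \<open>a\<close> means \<open>\<sigma>\<close> near \<open>a\<close> or near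
      \<open>- a\<close>, which is why two values of \<open>c\<close> occur.\<close>
    consider "\<bar>\<sigma> x\<bar> \<le> a - \<delta>" | "a + \<delta> \<le> \<bar>\<sigma> x\<bar>" | "\<bar>\<sigma> x - a\<bar> \<le> \<delta>" | "\<bar>\<sigma> x - (- a)\<bar> \<le> \<delta>"
      by linarith
    then show ?thesis
    proof cases
      case 1
      then show ?thesis
        using \<phi>_1[of x a] \<phi>_1[of x "a + \<delta>"] *[of a] *[of "- a"] \<open>\<delta> > 0\<close> by (simp add: distrib_left)
    next
      case 2
      then show ?thesis
        using \<phi>_0[of a x] \<phi>_0[of "a + \<delta>" x] *[of a] *[of "- a"] \<open>\<delta> > 0\<close> by (simp add: distrib_left)
    next
      case 3
      have "?u x - ?l x \<le> B * G x"
        using between[OF x] wG[OF x] \<phi>_01[of a x] mult_left_le[OF \<phi>_01(2)[of "a + \<delta>" x] wG(1)[OF x]]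
          mult_nonneg_nonneg[OF wG(1)[OF x] \<phi>_01(1)[of a x]] by linarith
      then show ?thesis
        using near[OF 3] *[of "- a"] by (simp add: distrib_left)
    next
      case 4
      have "?u x - ?l x \<le> B * G x"
        using between[OF x] wG[OF x] \<phi>_01[of a x] mult_left_le[OF \<phi>_01(2)[of "a + \<delta>" x] wG(1)[OF x]]
          mult_nonneg_nonneg[OF wG(1)[OF x] \<phi>_01(1)[of a x]] by linarith
      then show ?thesis
        using near[OF 4] *[of a] by (simp add: distrib_left)
    qed
  qed
  have "integral (cbox p q) (\<lambda>x. ?u x - ?l x) \<le> integral (cbox p q) (\<lambda>x. B * s * (k a x + k (- a) x))"
    using w cont_\<phi> cont_k diff by (intro integral_le integrable_continuous continuous_intros) auto
  also have "\<dots> = B * s * (integral (cbox p q) (k a) + integral (cbox p q) (k (- a)))"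
    using cont_k by (simp add: integral_add integrable_continuous)
  also have "\<dots> \<le> B * s * (C + C)"
    using \<open>0 \<le> B\<close> \<open>s > 0\<close> unfolding k_def
    by (intro mult_left_mono add_mono bound[OF \<open>\<delta> > 0\<close>]) auto
  also have "\<dots> < e"
    using s by (simp add: mult_ac)
  finally have "integral (cbox p q) (\<lambda>x. ?u x - ?l x) < e" .
  with cont between show ?thesis
    by blast
qed

text \<open>The truncation above is \<open>w\<close> minus the truncation below, so
  \<open>w - u\<close> and \<open>w - l\<close> enclose it with the same gap.\<close>

lemma
  fixes \<sigma> G w :: "'a::euclidean_space \<Rightarrow> real"
  assumes \<sigma>: "continuous_on (cbox p q) \<sigma>" and G: "continuous_on (cbox p q) G"
    and w: "continuous_on (cbox p q) w"
    and wG: "\<And>x. x \<in> cbox p q \<Longrightarrow> 0 \<le> w x" "\<And>x. x \<in> cbox p q \<Longrightarrow> w x \<le> B * G x"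
    and "0 \<le> B" "0 < C"
    and bound: "\<And>c e. e > 0 \<Longrightarrow> integral (cbox p q) (\<lambda>x. G x / sqrt (\<bar>\<sigma> x - c\<bar> + e)) \<le> C"
  shows has_riemann_integral_truncated_below:
    "has_riemann_integral (\<lambda>x. if \<bar>\<sigma> x\<bar> < a then w x else 0)
       (integral (cbox p q) (\<lambda>x. if \<bar>\<sigma> x\<bar> < a then w x else 0)) (cbox p q)"
    and has_riemann_integral_truncated_above:
    "has_riemann_integral (\<lambda>x. if \<bar>\<sigma> x\<bar> < a then 0 else w x)
       (integral (cbox p q) (\<lambda>x. if \<bar>\<sigma> x\<bar> < a then 0 else w x)) (cbox p q)"
proof -
  note straddle = truncation_straddle[OF assms, where a = a]
  show "has_riemann_integral (\<lambda>x. if \<bar>\<sigma> x\<bar> < a then w x else 0)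
       (integral (cbox p q) (\<lambda>x. if \<bar>\<sigma> x\<bar> < a then w x else 0)) (cbox p q)"
    using straddle by (rule has_riemann_integral_straddle)
  show "has_riemann_integral (\<lambda>x. if \<bar>\<sigma> x\<bar> < a then 0 else w x)
       (integral (cbox p q) (\<lambda>x. if \<bar>\<sigma> x\<bar> < a then 0 else w x)) (cbox p q)"
  proof (rule has_riemann_integral_straddle)
    fix e :: real
    assume "e > 0"
    then obtain l u where lu: "continuous_on (cbox p q) l" "continuous_on (cbox p q) u"
      "\<And>x. x \<in> cbox p q \<Longrightarrow> l x \<le> (if \<bar>\<sigma> x\<bar> < a then w x else 0)"
      "\<And>x. x \<in> cbox p q \<Longrightarrow> (if \<bar>\<sigma> x\<bar> < a then w x else 0) \<le> u x"
      "integral (cbox p q) (\<lambda>x. u x - l x) < e"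
      using straddle by meson
    have "w x - u x \<le> (if \<bar>\<sigma> x\<bar> < a then 0 else w x) \<and> (if \<bar>\<sigma> x\<bar> < a then 0 else w x) \<le> w x - l x"
      if "x \<in> cbox p q" for x
      using lu(3,4)[OF that] by (auto split: if_splits)
    moreover have "continuous_on (cbox p q) (\<lambda>x. w x - u x)" "continuous_on (cbox p q) (\<lambda>x. w x - l x)"
      using w lu by (auto intro: continuous_intros)
    moreover have "integral (cbox p q) (\<lambda>x. (w x - l x) - (w x - u x)) < e"
      using lu(5) by simp
    ultimately show "\<exists>l u. continuous_on (cbox p q) l \<and> continuous_on (cbox p q) u \<and>
        (\<forall>x\<in>cbox p q. l x \<le> (if \<bar>\<sigma> x\<bar> < a then 0 else w x) \<and> (if \<bar>\<sigma> x\<bar> < a then 0 else w x) \<le> u x) \<and>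
        integral (cbox p q) (\<lambda>x. u x - l x) < e"
      by blast
  qed
qed

section \<open>The bounds for both integrals from the uniform estimate\<close>

theorem proposition1:
  fixes Q Q1 :: "(real ^ 'n) set"
    and \<sigma> :: "real ^ 'n \<Rightarrow> real"
    and f :: "real \<Rightarrow> real"
  assumes "closed_cube Q"
    and "open Q1" and "Q \<subseteq> Q1"
    and "\<sigma> twice_differentiable_on Q1"
    and "\<exists>M. \<forall>x\<in>Q1. \<forall>i j. \<bar>partial_deriv j (partial_deriv i \<sigma>) x\<bar> \<le> M"
    and "\<forall>x\<in>Q. \<bar>\<sigma> x\<bar> < 1"
    and "strict_antimono_on {0<..1} f"
    and "\<forall>\<xi>\<in>{0<..1}. 0 < f \<xi>"
    and "smooth_real_on {0<..1} f"
    and "bounded ((\<lambda>\<xi>. f \<xi> * sqrt \<xi>) ` {0<..1})"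
    and "improper_integral_converges (\<lambda>\<xi>. f \<xi> / sqrt \<xi>)"
  shows "\<exists>C1>0. \<exists>C2>0. \<forall>a. 0 < a \<and> a < 1 / 2 \<longrightarrow>
           Gamma1_integrand \<sigma> a riemann_integrable_on Q \<and>
           Gamma2_integrand \<sigma> f a riemann_integrable_on Q \<and>
           Gamma1 Q \<sigma> a < C1 * sqrt a \<and> Gamma2 Q \<sigma> f a < C2"
proof -
  obtain p q where Q: "Q = cbox p q"
    using assms(1) by (auto simp: closed_cube_def)
  define G where "G x = norm (grad \<sigma> x)" for x
  obtain C where "C > 0" and bound:
    "\<And>c e. e > 0 \<Longrightarrow> integral (cbox p q) (\<lambda>x. G x / sqrt (\<bar>\<sigma> x - c\<bar> + e)) \<le> C"
  proof -
    obtain M where M: "\<And>x i j. x \<in> Q1 \<Longrightarrow> \<bar>partial_deriv j (partial_deriv i \<sigma>) x\<bar> \<le> M"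
      using assms(5) by blast
    show ?thesis
      using grad_over_sqrt_bound[of p q Q1 \<sigma> M, OF _ assms(4) M] assms(3,6) that
      unfolding Q G_def by (meson less_imp_le)
  qed
  have \<sigma>: "continuous_on (cbox p q) \<sigma>" and "continuous_on (cbox p q) (grad \<sigma>)"
    using assms(3,4) unfolding twice_differentiable_on_def Q
    by (auto intro!: continuous_at_imp_continuous_on differentiable_imp_continuous_within)
  then have G: "continuous_on (cbox p q) G"
    unfolding G_def by (intro continuous_intros)
  obtain B where "B > 0" and B: "\<And>\<xi>. \<xi> \<in> {0<..1} \<Longrightarrow> f \<xi> * sqrt \<xi> \<le> B"
    using assms(10) unfolding bounded_pos by (force simp: abs_le_iff)
  have f_cont: "continuous_on {0<..1} f"
    using assms(9) unfolding smooth_real_on_def by (metis DERIV_continuous_on)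
  have "\<bar>\<sigma> x\<bar> < 1" if "x \<in> cbox p q" for x
    using assms(6) that Q by simp
  note \<sigma>_less = this
  have main: "Gamma1_integrand \<sigma> a riemann_integrable_on Q \<and>
      Gamma2_integrand \<sigma> f a riemann_integrable_on Q \<and>
      Gamma1 Q \<sigma> a \<le> sqrt 2 * C * sqrt a \<and> Gamma2 Q \<sigma> f a \<le> sqrt 2 * B * C"
    if a: "0 < a" "a < 1 / 2" for a
  proof -
    \<comment> \<open>The maximum keeps the argument of \<open>f\<close> in [a, 1], where
      \<open>f\<close> is continuous and at most \<open>f a\<close>; where
      \<open>\<bar>\<sigma>\<bar> \<ge> a\<close> nothing changes.\<close>
    define w where "w x = G x * f (max \<bar>\<sigma> x\<bar> a)" for x
    have max_in: "max \<bar>\<sigma> x\<bar> a \<in> {0<..1}" if "x \<in> cbox p q" for x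
      using \<sigma>_less[OF that] a by auto
    have w: "continuous_on (cbox p q) w"
      unfolding w_def using max_in \<sigma> G
      by (intro continuous_intros continuous_on_compose2[OF f_cont]) auto
    have G0: "0 \<le> G x" for x
      by (simp add: G_def)
    have w0: "0 \<le> w x" if "x \<in> cbox p q" for x
      unfolding w_def using assms(8) max_in[OF that] G0 by (simp add: less_imp_le)
    have "f (max \<bar>\<sigma> x\<bar> a) \<le> f a" if "x \<in> cbox p q" for x
      using assms(7) max_in[OF that] a unfolding monotone_on_def
      by (cases "\<bar>\<sigma> x\<bar> \<le> a") (auto simp: max_def less_imp_le)
    then have wG: "w x \<le> f a * G x" if "x \<in> cbox p q" for x
      unfolding w_def using that G0[of x] by (simp add: mult.commute mult_left_mono)
    have "0 \<le> f a"
      using assms(8) a by (simp add: less_imp_le)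
    have eq1: "Gamma1_integrand \<sigma> a = (\<lambda>x. if \<bar>\<sigma> x\<bar> < a then G x else 0)"
      by (auto simp: Gamma1_integrand_def truncated_grad_def G_def)
    \<comment> \<open>Zeros of \<open>\<sigma>\<close> satisfy
      \<open>\<bar>\<sigma>\<bar> < a\<close>, so the value prescribed there agrees with the
      truncation.\<close>
    have eq2: "Gamma2_integrand \<sigma> f a = (\<lambda>x. if \<bar>\<sigma> x\<bar> < a then 0 else w x)"
      using a by (auto simp: Gamma2_integrand_def truncated_grad_def G_def w_def fun_eq_iff max_def)
    have R1: "has_riemann_integral (Gamma1_integrand \<sigma> a) (integral Q (Gamma1_integrand \<sigma> a)) Q"
      unfolding Q eq1 using G0 \<open>C > 0\<close> bound
      by (intro has_riemann_integral_truncated_below[OF \<sigma> G G, where B = 1]) auto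
    \<comment> \<open>The factor \<open>f a\<close> depends on \<open>a\<close>, which is harmless:
      it serves integrability only, and the size is bounded below through \<open>B\<close>.\<close>
    have R2: "has_riemann_integral (Gamma2_integrand \<sigma> f a) (integral Q (Gamma2_integrand \<sigma> f a)) Q"
      unfolding Q eq2 using w0 wG \<open>0 \<le> f a\<close> \<open>C > 0\<close> bound
      by (intro has_riemann_integral_truncated_above[OF \<sigma> G w, where B = "f a"]) auto
    \<comment> \<open>The case \<open>c = 0\<close>, \<open>e = a\<close> of \<open>bound\<close>,
      with \<open>- 0\<close> kept to match its form.\<close>
    let ?k = "\<lambda>x. G x / sqrt (\<bar>\<sigma> x - 0\<bar> + a)"
    have k: "continuous_on (cbox p q) ?k"
      using \<sigma> G a by (intro continuous_intros) auto
    have k_bound: "integral Q (\<lambda>x. c * ?k x) \<le> c * C" if "c \<ge> 0" for c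
      using mult_left_mono[OF bound[OF a(1), of 0] that] unfolding Q by (simp only: integral_mult_right)
    have ck: "(\<lambda>x. c * ?k x) integrable_on Q" for c
      unfolding Q using k by (intro integrable_continuous continuous_on_mult_left)
    have "integral Q (Gamma1_integrand \<sigma> a) \<le> integral Q (\<lambda>x. sqrt 2 * sqrt a * ?k x)"
    proof (rule integral_le[OF _ ck])
      show "Gamma1_integrand \<sigma> a integrable_on Q"
        using has_riemann_integral_imp_has_integral R1 Q by blast
      show "Gamma1_integrand \<sigma> a x \<le> sqrt 2 * sqrt a * ?k x" for x
      proof (cases "\<bar>\<sigma> x\<bar> < a")
        case True
        then have "sqrt (\<bar>\<sigma> x\<bar> + a) \<le> sqrt 2 * sqrt a"
          by (simp add: real_sqrt_mult[symmetric])
        moreover have "0 < sqrt (\<bar>\<sigma> x\<bar> + a)"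
          using a by simp
        ultimately have "1 \<le> sqrt 2 * sqrt a / sqrt (\<bar>\<sigma> x\<bar> + a)"
          by simp
        from mult_left_mono[OF this G0[of x]] show ?thesis
          using True by (simp add: eq1 mult_ac)
      qed (use a G0 in \<open>simp add: eq1\<close>)
    qed
    also have "\<dots> \<le> sqrt 2 * sqrt a * C"
      using a by (intro k_bound) simp
    finally have I1: "integral Q (Gamma1_integrand \<sigma> a) \<le> sqrt 2 * C * sqrt a"
      by (simp add: mult_ac)
    have "integral Q (Gamma2_integrand \<sigma> f a) \<le> integral Q (\<lambda>x. sqrt 2 * B * ?k x)"
    proof (rule integral_le[OF _ ck])
      show "Gamma2_integrand \<sigma> f a integrable_on Q"
        using has_riemann_integral_imp_has_integral R2 Q by blast
      show "Gamma2_integrand \<sigma> f a x \<le> sqrt 2 * B * ?k x" if x: "x \<in> Q" for x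
      proof (cases "\<bar>\<sigma> x\<bar> < a")
        case False
        let ?s = "\<bar>\<sigma> x\<bar>"
        have s: "?s \<in> {0<..1}"
          using False a \<sigma>_less[of x] x Q by auto
        have "sqrt (?s + a) \<le> sqrt 2 * sqrt ?s"
          using False by (simp add: real_sqrt_mult[symmetric])
        then have "f ?s * sqrt (?s + a) \<le> f ?s * (sqrt 2 * sqrt ?s)"
          using assms(8) s by (intro mult_left_mono) (auto simp: less_imp_le)
        also have "\<dots> \<le> sqrt 2 * B"
          using B[OF s] by (simp add: mult_ac)
        finally have "f ?s \<le> sqrt 2 * B / sqrt (?s + a)"
          using a by (simp add: pos_le_divide_eq)
        from mult_left_mono[OF this G0[of x]] show ?thesis
          using False by (simp add: eq2 w_def max_def mult_ac)
      qed (use a G0 \<open>B > 0\<close> in \<open>simp add: eq2\<close>)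
    qed
    also have "\<dots> \<le> sqrt 2 * B * C"
      using \<open>B > 0\<close> by (intro k_bound) simp
    finally have I2: "integral Q (Gamma2_integrand \<sigma> f a) \<le> sqrt 2 * B * C" .
    \<comment> \<open>\<open>riemann_integral\<close> is a definite description; the existence in
      \<open>R1\<close> and \<open>R2\<close> identifies it with the gauge integrals just
      estimated.\<close>
    have "Gamma1 Q \<sigma> a = integral Q (Gamma1_integrand \<sigma> a)"
      "Gamma2 Q \<sigma> f a = integral Q (Gamma2_integrand \<sigma> f a)"
      using R1 R2 unfolding Gamma1_def Gamma2_def Q by (simp_all add: riemann_integral_unique)
    with R1 R2 I1 I2 show ?thesis
      unfolding riemann_integrable_on_def by auto
  qed
  \<comment> \<open>Adding 1 to each constant makes both inequalities strict, the first because
    \<open>sqrt a > 0\<close>.\<close>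
  have "sqrt 2 * C * sqrt a < (sqrt 2 * C + 1) * sqrt a" if "0 < a" for a
    using that by (simp add: distrib_right)
  with main have "\<forall>a. 0 < a \<and> a < 1 / 2 \<longrightarrow> Gamma1_integrand \<sigma> a riemann_integrable_on Q \<and>
      Gamma2_integrand \<sigma> f a riemann_integrable_on Q \<and>
      Gamma1 Q \<sigma> a < (sqrt 2 * C + 1) * sqrt a \<and> Gamma2 Q \<sigma> f a < sqrt 2 * B * C + 1"
    by (meson less_add_one order_le_less_trans)
  moreover have "0 < sqrt 2 * C + 1" "0 < sqrt 2 * B * C + 1"
    using \<open>C > 0\<close> \<open>B > 0\<close> by (simp_all add: add_pos_pos)
  ultimately show ?thesis
    by blast
qed

end
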